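(* Let $\Gamma$ be a triangle-free finite simplicial graph and let $G$ be a subgroup of the right-angled Coxeter group $W_\Gamma$. Suppose that $G$ is isomorphic to the right-angled Coxeter group $W_{\Gamma'}$, where $\Gamma'$ is a finite simplicial graph that does not have an isolated vertex. Then $G$ is generated by a finite set of reflections in $W_\Gamma$.
   Context: For a finite simplicial graph $\Gamma$, $W_\Gamma=\langle V(\Gamma)\mid s^2=1 \ (s\in V(\Gamma)),\ st=ts \text{ if } s,t \text{ are adjacent}\rangle$ is the associated right-angled Coxeter group. A reflection in $W_\Gamma$ is an element of the form $wsw^{-1}$ with $s\in V(\Gamma)$, $w\in W_\Gamma$. An isolated vertex of a graph is a vertex not adjacent to any other vertex. (Every Coxeter subgroup of a right-angled Coxeter group, i.e. subgroup isomorphic to some finitely generated Coxeter group, is itself a right-angled Coxeter group.) *)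

theory Defs
  imports "HOL-Algebra.Generated_Groups" "Graph_Theory.Pair_Digraph"
begin

section \<open>Groups given by generators and relations\<close>

text \<open>A word over \<open>S\<close> is a list of letters \<open>(s, e)\<close> with \<open>s \<in> S\<close>, where \<open>(s, True)\<close> stands for
  the generator \<open>s\<close> and \<open>(s, False)\<close> for its formal inverse.\<close>

type_synonym 'a word = "('a \<times> bool) list"

definition words :: "'a set \<Rightarrow> 'a word set" where
  "words S = lists (S \<times> UNIV)"

text \<open>Equality of words in the group \<open>\<langle>S | l = r for (l, r) \<in> R\<rangle>\<close>.\<close>

inductive pres_eq :: "'a set \<Rightarrow> ('a word \<times> 'a word) set \<Rightarrow> 'a word \<Rightarrow> 'a word \<Rightarrow> bool"
  for S R where
  refl: "w \<in> words S \<Longrightarrow> pres_eq S R w w"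
| sym: "pres_eq S R v w \<Longrightarrow> pres_eq S R w v"
| trans: "pres_eq S R u v \<Longrightarrow> pres_eq S R v w \<Longrightarrow> pres_eq S R u w"
| cancel: "u \<in> words S \<Longrightarrow> v \<in> words S \<Longrightarrow> s \<in> S \<Longrightarrow>
    pres_eq S R (u @ [(s, e), (s, \<not> e)] @ v) (u @ v)"
| relation: "u \<in> words S \<Longrightarrow> v \<in> words S \<Longrightarrow> l \<in> words S \<Longrightarrow> r \<in> words S \<Longrightarrow> (l, r) \<in> R \<Longrightarrow>
    pres_eq S R (u @ l @ v) (u @ r @ v)"

definition pres_class :: "'a set \<Rightarrow> ('a word \<times> 'a word) set \<Rightarrow> 'a word \<Rightarrow> 'a word set" where
  "pres_class S R w = {v. pres_eq S R w v}"

definition presented_group :: "'a set \<Rightarrow> ('a word \<times> 'a word) set \<Rightarrow> 'a word set monoid" where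
  "presented_group S R =
    \<lparr>carrier = pres_class S R ` words S,
     monoid.mult = (\<lambda>A B. \<Union>a\<in>A. \<Union>b\<in>B. pres_class S R (a @ b)),
     one = pres_class S R []\<rparr>"

lemma pres_eq_words: "pres_eq S R v w \<Longrightarrow> v \<in> words S \<and> w \<in> words S"
  by (induction rule: pres_eq.induct) (auto simp: words_def)

lemma pres_eq_context:
  assumes "pres_eq S R v w" "p \<in> words S" "q \<in> words S"
  shows "pres_eq S R (p @ v @ q) (p @ w @ q)"
  using assms
proof (induction rule: pres_eq.induct)
  case (refl w)
  then show ?case by (intro pres_eq.refl) (auto simp: words_def)
next
  case (sym v w)
  then show ?case by (simp add: pres_eq.sym)
next
  case (trans u v w)
  then show ?case by (metis pres_eq.trans)
next
  case (cancel u v s e)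
  then show ?case
    using pres_eq.cancel[of "p @ u" S "v @ q" s R e] by (auto simp: words_def)
next
  case (relation u v l r)
  then show ?case
    using pres_eq.relation[of "p @ u" S "v @ q" l r R] by (auto simp: words_def)
qed

lemma pres_eq_append:
  assumes "pres_eq S R u u'" "pres_eq S R v v'"
  shows "pres_eq S R (u @ v) (u' @ v')"
proof -
  have w: "u' \<in> words S" "v \<in> words S" "[] \<in> words S"
    using pres_eq_words[OF assms(1)] pres_eq_words[OF assms(2)] by (auto simp: words_def)
  show ?thesis
    using pres_eq_context[OF assms(1) w(3) w(2)] pres_eq_context[OF assms(2) w(1) w(3)]
    by (metis append_Nil append_Nil2 pres_eq.trans)
qed

lemma pres_class_eq_iff:
  "w \<in> words S \<Longrightarrow> pres_class S R v = pres_class S R w \<longleftrightarrow> pres_eq S R v w"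
  unfolding pres_class_def
  by (metis (mono_tags, lifting) Collect_cong mem_Collect_eq pres_eq.refl pres_eq.sym pres_eq.trans)

lemma presented_group_mult:
  assumes "u \<in> words S" "v \<in> words S"
  shows "pres_class S R u \<otimes>\<^bsub>presented_group S R\<^esub> pres_class S R v = pres_class S R (u @ v)"
proof -
  have "pres_class S R (a @ b) = pres_class S R (u @ v)"
    if "pres_eq S R u a" "pres_eq S R v b" for a b
  proof -
    have "pres_eq S R (a @ b) (u @ v)"
      using pres_eq_append[OF that] by (rule pres_eq.sym)
    then show ?thesis
      using assms by (subst pres_class_eq_iff) (auto simp: words_def)
  qed
  moreover have "pres_eq S R u u" "pres_eq S R v v"
    using assms by (auto intro: pres_eq.refl)
  ultimately have "(\<Union>a\<in>pres_class S R u. \<Union>b\<in>pres_class S R v. pres_class S R (a @ b)) =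
      pres_class S R (u @ v)"
    unfolding pres_class_def [of S R u] pres_class_def [of S R v] by blast
  then show ?thesis by (simp add: presented_group_def)
qed

lemma pres_eq_inverse:
  "w \<in> words S \<Longrightarrow> pres_eq S R (map (apsnd Not) (rev w) @ w) []"
proof (induction w)
  case Nil
  then show ?case by (auto simp: words_def intro: pres_eq.refl)
next
  case (Cons x w)
  obtain s e where x: "x = (s, e)" by force
  let ?w = "map (apsnd Not) (rev w)"
  have w: "?w \<in> words S" "w \<in> words S" "s \<in> S"
    using Cons.prems x by (auto simp: words_def in_lists_conv_set)
  have "pres_eq S R (?w @ [(s, \<not> e), (s, \<not> \<not> e)] @ w) (?w @ w)"
    using w by (rule pres_eq.cancel)
  then have "pres_eq S R (map (apsnd Not) (rev (x # w)) @ x # w) (?w @ w)"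
    by (simp add: x)
  then show ?case
    using Cons.IH[OF w(2)] by (rule pres_eq.trans)
qed

lemma group_presented_group: "group (presented_group S R)"
proof (rule groupI)
  let ?G = "presented_group S R"
  have C: "carrier ?G = pres_class S R ` words S" and O: "\<one>\<^bsub>?G\<^esub> = pres_class S R []"
    by (auto simp: presented_group_def)
  have N: "[] \<in> words S" and A: "\<And>u v. u \<in> words S \<Longrightarrow> v \<in> words S \<Longrightarrow> u @ v \<in> words S"
    by (auto simp: words_def)
  show "x \<otimes>\<^bsub>?G\<^esub> y \<in> carrier ?G" if "x \<in> carrier ?G" "y \<in> carrier ?G" for x y
    using that by (auto simp: C presented_group_mult A)
  show "\<one>\<^bsub>?G\<^esub> \<in> carrier ?G" by (simp add: C O N)
  show "x \<otimes>\<^bsub>?G\<^esub> y \<otimes>\<^bsub>?G\<^esub> z = x \<otimes>\<^bsub>?G\<^esub> (y \<otimes>\<^bsub>?G\<^esub> z)"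
    if "x \<in> carrier ?G" "y \<in> carrier ?G" "z \<in> carrier ?G" for x y z
    using that by (auto simp: C presented_group_mult A)
  show "\<one>\<^bsub>?G\<^esub> \<otimes>\<^bsub>?G\<^esub> x = x" if "x \<in> carrier ?G" for x
    using that by (auto simp: C O presented_group_mult N)
  show "\<exists>y\<in>carrier ?G. y \<otimes>\<^bsub>?G\<^esub> x = \<one>\<^bsub>?G\<^esub>" if x: "x \<in> carrier ?G" for x
  proof -
    obtain w where w: "w \<in> words S" "x = pres_class S R w" using x C by auto
    have "map (apsnd Not) (rev w) \<in> words S"
      using w(1) by (auto simp: words_def in_lists_conv_set)
    with w pres_eq_inverse[OF w(1), of R] N show ?thesis
      by (intro bexI[of _ "pres_class S R (map (apsnd Not) (rev w))"])
        (auto simp: C O presented_group_mult pres_class_eq_iff)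
  qed
qed

section \<open>Right-angled Coxeter groups\<close>

text \<open>Finite simplicial graphs are modelled by the locale predicate \<^term>\<open>pair_graph\<close>:
  finitely many vertices \<^const>\<open>pverts\<close> and a symmetric irreflexive adjacency relation
  \<^const>\<open>parcs\<close> on them.\<close>

definition racg_relations :: "'a pair_pre_digraph \<Rightarrow> ('a word \<times> 'a word) set" where
  "racg_relations \<Gamma> =
    {([(s, True), (s, True)], []) | s. s \<in> pverts \<Gamma>} \<union>
    {([(s, True), (t, True)], [(t, True), (s, True)]) | s t. (s, t) \<in> parcs \<Gamma>}"

definition racg :: "'a pair_pre_digraph \<Rightarrow> 'a word set monoid" where
  "racg \<Gamma> = presented_group (pverts \<Gamma>) (racg_relations \<Gamma>)"

definition racg_gen :: "'a pair_pre_digraph \<Rightarrow> 'a \<Rightarrow> 'a word set" where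
  "racg_gen \<Gamma> s = pres_class (pverts \<Gamma>) (racg_relations \<Gamma>) [(s, True)]"

lemma group_racg: "group (racg \<Gamma>)"
  unfolding racg_def by (rule group_presented_group)

definition reflections :: "'a pair_pre_digraph \<Rightarrow> 'a word set set" where
  "reflections \<Gamma> = {w \<otimes>\<^bsub>racg \<Gamma>\<^esub> racg_gen \<Gamma> s \<otimes>\<^bsub>racg \<Gamma>\<^esub> inv\<^bsub>racg \<Gamma>\<^esub> w | w s.
    w \<in> carrier (racg \<Gamma>) \<and> s \<in> pverts \<Gamma>}"

definition triangle_free :: "'a pair_pre_digraph \<Rightarrow> bool" where
  "triangle_free \<Gamma> \<longleftrightarrow>
    \<not> (\<exists>u v w. (u, v) \<in> parcs \<Gamma> \<and> (v, w) \<in> parcs \<Gamma> \<and> (w, u) \<in> parcs \<Gamma>)"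

definition isolated_vertex :: "'a pair_pre_digraph \<Rightarrow> 'a \<Rightarrow> bool" where
  "isolated_vertex \<Gamma> v \<longleftrightarrow> v \<in> pverts \<Gamma> \<and> (\<forall>u\<in>pverts \<Gamma>. u \<noteq> v \<longrightarrow> (v, u) \<notin> parcs \<Gamma>)"

end

theory Submission
  imports Defs "HOL-Library.Multiset"
begin

text \<open>Write \<open>W\<close> for the right-angled Coxeter group of \<open>\<Gamma>\<close>.  In any such group an involution is
  conjugate to a product of pairwise adjacent vertices; without triangles such a product has at most
  two factors (lemma \<open>involution_clique_conj\<close>).  So an involution that is not a reflection is
  conjugate to some \<open>s t\<close> with \<open>s\<close>, \<open>t\<close> adjacent.  As \<open>s\<close> and \<open>t\<close> have no common neighbour, the
  centralizer of \<open>s t\<close> is just the Klein four-group \<open>{1, s, t, s t}\<close> (lemma \<open>centralizer_edge\<close>).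
  Hence, if \<open>a\<close> is an involution that is not a reflection and \<open>b \<noteq> 1, a\<close> commutes with \<open>a\<close>, then
  both \<open>b\<close> and \<open>a b\<close> are reflections (lemma \<open>commuting_nonreflection\<close>).

  Now let \<open>g v\<close> be the image in \<open>G\<close> of a vertex \<open>v\<close> of \<open>\<Gamma>'\<close>.  The vertex \<open>v\<close> has a neighbour \<open>u\<close>,
  and if \<open>g v\<close> is not a reflection, then \<open>g u\<close> and \<open>g v g u\<close> are reflections whose product is
  \<open>g v\<close>.  So \<open>G\<close> is generated by those elements \<open>g v\<close> (\<open>v\<close> a vertex) and \<open>g u g v\<close> (\<open>u v\<close> an
  edge) that are reflections.

  Both facts about \<open>W\<close> rest on the solution of the word problem: two reduced words with the same
  value differ only by swaps of adjacent letters (lemma \<open>reduced_word_unique\<close>).  Applied to a word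
  and its reversal, it describes involutions; applied to \<open>s t w\<close> and \<open>w s t\<close>, it describes the
  centralizer of \<open>s t\<close>.  It is proved by letting the generators act on reduced words up to
  commutation.\<close>

section \<open>Words up to commutation\<close>

locale commutation =
  fixes E :: "'a \<Rightarrow> 'a \<Rightarrow> bool"
  assumes E_sym: "E a b \<Longrightarrow> E b a"
    and E_irrefl: "\<not> E a a"
begin

text \<open>Two words can be turned into each other by swapping neighbouring commuting letters if and only
  if, for each pair of non-commuting letters, they have the same subsequence of those letters.
  Taking this as the definition makes cancellation laws immediate, with no induction over sequences
  of swaps.  The case \<open>a = b\<close>, allowed because \<open>E\<close> is irreflexive, compares multiplicities.\<close>

definition trace_eq :: "'a list \<Rightarrow> 'a list \<Rightarrow> bool" (infix "\<approx>" 50) where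
  "u \<approx> v \<longleftrightarrow> (\<forall>a b. \<not> E a b \<longrightarrow>
     filter (\<lambda>x. x = a \<or> x = b) u = filter (\<lambda>x. x = a \<or> x = b) v)"

lemma trace_eq_refl [simp]: "u \<approx> u"
  and trace_eq_sym: "u \<approx> v \<Longrightarrow> v \<approx> u"
  and trace_eq_trans [trans]: "u \<approx> v \<Longrightarrow> v \<approx> w \<Longrightarrow> u \<approx> w"
  by (auto simp: trace_eq_def)

lemma trace_eq_rev: "u \<approx> v \<Longrightarrow> rev u \<approx> rev v"
  unfolding trace_eq_def by (metis rev_filter)

lemma trace_eq_Cons_iff [simp]: "s # u \<approx> s # v \<longleftrightarrow> u \<approx> v"
  by (auto simp: trace_eq_def)

lemma trace_eq_Cons: "u \<approx> v \<Longrightarrow> s # u \<approx> s # v"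
  by simp

lemma trace_eq_mset:
  assumes "u \<approx> v"
  shows "mset u = mset v"
proof (rule multiset_eqI)
  fix a
  have "filter (\<lambda>x. x = a \<or> x = a) u = filter (\<lambda>x. x = a \<or> x = a) v"
    using assms E_irrefl unfolding trace_eq_def by blast
  then have "filter (\<lambda>x. x = a) u = filter (\<lambda>x. x = a) v" by simp
  then have "size (filter_mset (\<lambda>x. x = a) (mset u)) = size (filter_mset (\<lambda>x. x = a) (mset v))"
    by (metis mset_filter)
  then show "count (mset u) a = count (mset v) a"
    by (simp add: filter_eq_replicate_mset)
qed

lemma trace_eq_length: "u \<approx> v \<Longrightarrow> length u = length v"
  by (metis trace_eq_mset size_mset)

lemma trace_eq_set: "u \<approx> v \<Longrightarrow> set u = set v"
  by (metis trace_eq_mset set_mset_mset)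

text \<open>The letter \<open>s\<close> can be moved to the front.\<close>

definition leading :: "'a \<Rightarrow> 'a list \<Rightarrow> bool" where
  "leading s w \<longleftrightarrow> (\<exists>p q. w = p @ s # q \<and> (\<forall>x\<in>set p. E s x))"

lemma leading_Cons_same [simp]: "leading s (s # w)"
  unfolding leading_def by (rule exI[of _ "[]"]) auto

lemma leading_Cons: "s \<noteq> t \<Longrightarrow> leading s (t # w) \<longleftrightarrow> E s t \<and> leading s w"
  unfolding leading_def
proof (intro iffI conjI; (elim exE conjE)?)
  fix p q
  assume "s \<noteq> t" "t # w = p @ s # q" and p: "\<forall>x\<in>set p. E s x"
  then obtain p' where p': "p = t # p'" "w = p' @ s # q"
    by (auto simp: Cons_eq_append_conv)
  then show "E s t" "\<exists>p q. w = p @ s # q \<and> (\<forall>x\<in>set p. E s x)"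
    using p by auto
next
  fix p q
  assume "E s t" "w = p @ s # q" "\<forall>x\<in>set p. E s x"
  then show "\<exists>p q. t # w = p @ s # q \<and> (\<forall>x\<in>set p. E s x)"
    by (metis append_Cons set_ConsD)
qed

lemma leading_Nil [simp]: "\<not> leading s []"
  by (simp add: leading_def)

lemma remove1_split:
  assumes "\<forall>x\<in>set p. E s x"
  shows "remove1 s (p @ s # q) = p @ q"
proof -
  have "s \<notin> set p" using assms E_irrefl by auto
  then show ?thesis by (simp add: remove1_append)
qed

text \<open>The letters jumped over commute with \<open>s\<close>, so none of them lies in a common projection with \<open>s\<close>.\<close>

lemma leading_imp_trace_eq:
  assumes "leading s w"
  shows "w \<approx> s # remove1 s w"
proof -
  obtain p q where w: "w = p @ s # q" and p: "\<forall>x\<in>set p. E s x"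
    using assms leading_def by auto
  have "filter (\<lambda>x. x = a \<or> x = b) p = []" if "\<not> E a b" "s = a \<or> s = b" for a b
    using that p E_sym E_irrefl by (auto simp: filter_empty_conv)
  then show ?thesis
    unfolding w remove1_split[OF p] by (auto simp: trace_eq_def)
qed

text \<open>If a letter \<open>x\<close> before the first \<open>s\<close> in \<open>v\<close> did not commute with \<open>s\<close>, then the projections to
  \<open>{s, x}\<close> would start with different letters.\<close>

lemma trace_eq_Cons_imp_leading:
  assumes "s # u \<approx> v"
  shows "leading s v"
proof -
  have "s \<in> set v" using trace_eq_set[OF assms] by auto
  then obtain p q where v: "v = p @ s # q" and sp: "s \<notin> set p"
    by (meson split_list_first)
  have "E s x" if "x \<in> set p" for x
  proof (rule ccontr)
    assume "\<not> E s x"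
    then have "filter (\<lambda>y. y = s \<or> y = x) (s # u) = filter (\<lambda>y. y = s \<or> y = x) v"
      using assms unfolding trace_eq_def by blast
    moreover have "filter (\<lambda>y. y = s \<or> y = x) p \<noteq> []"
      using that by (auto simp: filter_empty_conv)
    then obtain z zs where "filter (\<lambda>y. y = s \<or> y = x) p = z # zs"
      by (auto simp: neq_Nil_conv)
    moreover from this have "z \<in> set p"
      by (metis filter_is_subset list.set_intros(1) subsetD)
    ultimately show False using sp by (auto simp: v)
  qed
  then show ?thesis using v leading_def by blast
qed

lemma leading_cong: "u \<approx> v \<Longrightarrow> leading s u \<longleftrightarrow> leading s v"
  by (meson leading_imp_trace_eq trace_eq_Cons_imp_leading trace_eq_sym trace_eq_trans)

lemma trace_eq_Cons_imp_remove1: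
  assumes "s # u \<approx> v"
  shows "u \<approx> remove1 s v"
  using trace_eq_trans[OF assms leading_imp_trace_eq[OF trace_eq_Cons_imp_leading[OF assms]]]
  by simp

text \<open>Quantifying over all words equivalent to \<open>w\<close>, rather than looking for two occurrences of \<open>s\<close> in
  \<open>w\<close> separated by letters that commute with it, makes invariance under commutation and under
  reversal evident.\<close>

definition reduced :: "'a list \<Rightarrow> bool" where
  "reduced w \<longleftrightarrow> \<not> (\<exists>p s r. w \<approx> p @ s # s # r)"

lemma reduced_Nil [simp]: "reduced []"
  unfolding reduced_def using trace_eq_length by fastforce

lemma reduced_cong: "u \<approx> v \<Longrightarrow> reduced u \<longleftrightarrow> reduced v"
  unfolding reduced_def by (meson trace_eq_sym trace_eq_trans)

lemma reduced_rev: "reduced w \<Longrightarrow> reduced (rev w)"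
  unfolding reduced_def
proof (rule notI, elim exE)
  fix p s r
  assume "\<not> (\<exists>p s r. w \<approx> p @ s # s # r)" "rev w \<approx> p @ s # s # r"
  moreover from this(2) have "w \<approx> rev r @ s # s # rev p"
    using trace_eq_rev by fastforce
  ultimately show False by blast
qed

text \<open>For the nontrivial direction, suppose that \<open>s # w\<close> is equivalent to a word with a factor \<open>t t\<close>.
  Deleting the first \<open>s\<close> of that word gives a word equivalent to \<open>w\<close>: either \<open>t t\<close> survives, so \<open>w\<close>
  is not reduced, or one of its letters was that \<open>s\<close>, and the other can be moved to the front of
  \<open>w\<close>.\<close>

lemma reduced_Cons: "reduced (s # w) \<longleftrightarrow> reduced w \<and> \<not> leading s w"
proof (intro iffI conjI notI)
  assume red: "reduced (s # w)"
  show "reduced w"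
    using red unfolding reduced_def by (metis append_Cons trace_eq_Cons)
  assume "leading s w"
  then have "s # w \<approx> [] @ s # s # remove1 s w"
    using leading_imp_trace_eq by simp
  with red show False unfolding reduced_def by blast
next
  assume asm: "reduced w \<and> \<not> leading s w"
  show "reduced (s # w)"
    unfolding reduced_def
  proof (rule notI, elim exE)
    fix p t r
    assume *: "s # w \<approx> p @ t # t # r"
    have w: "w \<approx> remove1 s (p @ t # t # r)"
      using * by (rule trace_eq_Cons_imp_remove1)
    consider "s \<in> set p" | "s \<notin> set p" "s = t" | "s \<notin> set p" "s \<noteq> t" by blast
    then show False
    proof cases
      case 1
      then show False
        using w asm unfolding reduced_def by (auto simp: remove1_append)
    next
      case 2
      have "leading s (p @ s # s # r)"
        using trace_eq_Cons_imp_leading[OF *] 2 by simp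
      then obtain p' q' where "p @ s # s # r = p' @ s # q'" and p': "\<forall>x\<in>set p'. E s x"
        by (auto simp: leading_def)
      moreover have "s \<notin> set p'" using p' E_irrefl by auto
      moreover have "takeWhile (\<lambda>x. x \<noteq> s) (l @ s # m) = l" if "s \<notin> set l" for l m
        using that by (auto simp: takeWhile_append)
      ultimately have "p = p'" using 2(1) by metis
      then have "leading s (p @ s # r)" using p' leading_def by blast
      then show False
        using w asm 2 by (auto simp: remove1_append leading_cong)
    next
      case 3
      then show False
        using w asm unfolding reduced_def by (auto simp: remove1_append)
    qed
  qed
qed

text \<open>On reduced words up to commutation this is left multiplication by the generator \<open>s\<close>.  The lemmas
  below show that it satisfies the defining relations of the group, so that the group acts.\<close>

definition left_mult :: "'a \<Rightarrow> 'a list \<Rightarrow> 'a list" where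
  "left_mult s w = (if leading s w then remove1 s w else s # w)"

lemma left_mult_cong:
  assumes "u \<approx> v"
  shows "left_mult s u \<approx> left_mult s v"
proof (cases "leading s u")
  case True
  then have "leading s v" using leading_cong[OF assms] by simp
  have "s # remove1 s u \<approx> v"
    using leading_imp_trace_eq[OF True] assms trace_eq_sym trace_eq_trans by blast
  then show ?thesis
    using True \<open>leading s v\<close> trace_eq_Cons_imp_remove1 by (simp add: left_mult_def)
next
  case False
  then show ?thesis using assms leading_cong[OF assms] by (simp add: left_mult_def)
qed

lemma reduced_left_mult: "reduced w \<Longrightarrow> reduced (left_mult s w)"
  unfolding left_mult_def
  using reduced_cong[OF leading_imp_trace_eq[of s w]] by (auto simp: reduced_Cons)

lemma left_mult_involution:
  assumes "reduced w"
  shows "left_mult s (left_mult s w) \<approx> w"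
proof (cases "leading s w")
  case True
  have "\<not> leading s (remove1 s w)"
    using assms reduced_Cons reduced_cong[OF leading_imp_trace_eq[OF True]] by simp
  then show ?thesis
    using True leading_imp_trace_eq trace_eq_sym by (simp add: left_mult_def)
next
  case False
  then show ?thesis by (simp add: left_mult_def)
qed

lemma leading_left_mult:
  assumes "E s t"
  shows "leading s (left_mult t w) \<longleftrightarrow> leading s w"
proof -
  have st: "s \<noteq> t" using assms E_irrefl by auto
  have "leading s w \<longleftrightarrow> leading s (t # remove1 t w)" if "leading t w"
    using leading_cong leading_imp_trace_eq that by blast
  then show ?thesis
    using assms st by (auto simp: left_mult_def leading_Cons)
qed

text \<open>Multiplying by a letter that commutes with \<open>s\<close> does not change whether \<open>s\<close> can be moved to the
  front, so whether each of the two steps adds or deletes a letter does not depend on their order.\<close>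

lemma left_mult_commute:
  assumes "E s t"
  shows "left_mult s (left_mult t w) \<approx> left_mult t (left_mult s w)"
proof -
  have st: "s \<noteq> t" and ts: "E t s" using assms E_irrefl E_sym by auto
  have "s # t # w \<approx> t # s # w"
    using assms ts st by (auto simp: trace_eq_def)
  then show ?thesis
    using leading_left_mult[OF assms, of w] leading_left_mult[OF ts, of w] st
    by (auto simp: left_mult_def remove1_commute)
qed

definition normal_form :: "'a list \<Rightarrow> 'a list" where
  "normal_form w = foldr left_mult w []"

lemma normal_form_Nil [simp]: "normal_form [] = []"
  and normal_form_Cons [simp]: "normal_form (s # w) = left_mult s (normal_form w)"
  and normal_form_append: "normal_form (u @ v) = foldr left_mult u (normal_form v)"
  by (simp_all add: normal_form_def)

lemma foldr_left_mult_cong: "u \<approx> v \<Longrightarrow> foldr left_mult w u \<approx> foldr left_mult w v"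
  by (induction w) (auto intro: left_mult_cong)

lemma reduced_normal_form: "reduced (normal_form w)"
  by (induction w) (auto intro: reduced_left_mult)

lemma normal_form_reduced: "reduced w \<Longrightarrow> normal_form w \<approx> w"
proof (induction w)
  case (Cons s w)
  then have "normal_form w \<approx> w" "\<not> leading s w" by (auto simp: reduced_Cons)
  then show ?case using leading_cong by (simp add: left_mult_def)
qed simp

end

section \<open>The word problem in a right-angled Coxeter group\<close>

locale racg_graph = pair_graph \<Gamma> for \<Gamma> :: "'a pair_pre_digraph"
begin

abbreviation adj :: "'a \<Rightarrow> 'a \<Rightarrow> bool" where
  "adj s t \<equiv> (s, t) \<in> parcs \<Gamma>"

lemma adj_sym: "adj s t \<Longrightarrow> adj t s"
  using sym_arcs by (auto simp: symmetric_def elim: symE)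

sublocale commutation adj
proof unfold_locales
  show "adj b a" if "adj a b" for a b using that by (rule adj_sym)
  show "\<not> adj a a" for a using pair_no_loops[of "(a, a)"] by auto
qed

notation trace_eq (infix "\<approx>" 50)

sublocale W: group "racg \<Gamma>"
  by (rule group_racg)

abbreviation mul (infixl "\<cdot>" 70) where
  "x \<cdot> y \<equiv> x \<otimes>\<^bsub>racg \<Gamma>\<^esub> y"

abbreviation one_W ("\<e>") where "\<e> \<equiv> \<one>\<^bsub>racg \<Gamma>\<^esub>"

abbreviation gen :: "'a \<Rightarrow> 'a word set" where "gen \<equiv> racg_gen \<Gamma>"

text \<open>Since generators are their own inverses, words without formal inverses suffice.\<close>

definition word_val :: "'a list \<Rightarrow> 'a word set" where
  "word_val w = pres_class (pverts \<Gamma>) (racg_relations \<Gamma>) (map (\<lambda>s. (s, True)) w)"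

lemma signed_word_eq_positive:
  assumes "w \<in> words (pverts \<Gamma>)"
  shows "pres_eq (pverts \<Gamma>) (racg_relations \<Gamma>) w (map (\<lambda>s. (s, True)) (map fst w))"
  using assms
proof (induction w)
  case Nil
  then show ?case by (auto intro: pres_eq.refl)
next
  case (Cons x w)
  obtain s e where x: "x = (s, e)" by force
  have s: "s \<in> pverts \<Gamma>" and w: "w \<in> words (pverts \<Gamma>)"
    using Cons.prems x by (auto simp: words_def)
  have "pres_eq (pverts \<Gamma>) (racg_relations \<Gamma>) [(s, e)] [(s, True)]"
  proof (cases e)
    case True
    then show ?thesis using s by (auto simp: words_def intro: pres_eq.refl)
  next
    case False
    have "pres_eq (pverts \<Gamma>) (racg_relations \<Gamma>)
        ([(s, False)] @ [(s, True), (s, True)] @ []) ([(s, False)] @ [] @ [])"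
      by (rule pres_eq.relation) (use s in \<open>auto simp: words_def racg_relations_def\<close>)
    moreover have "pres_eq (pverts \<Gamma>) (racg_relations \<Gamma>)
        ([] @ [(s, False), (s, \<not> False)] @ [(s, True)]) ([] @ [(s, True)])"
      by (rule pres_eq.cancel) (use s in \<open>auto simp: words_def\<close>)
    ultimately show ?thesis
      using False by (auto intro: pres_eq.sym pres_eq.trans)
  qed
  from pres_eq_append[OF this Cons.IH[OF w]] show ?case by (simp add: x)
qed

lemma words_positive: "set w \<subseteq> pverts \<Gamma> \<Longrightarrow> map (\<lambda>s. (s, True)) w \<in> words (pverts \<Gamma>)"
  by (auto simp: words_def in_lists_conv_set)

lemma word_val_closed [simp]: "set w \<subseteq> pverts \<Gamma> \<Longrightarrow> word_val w \<in> carrier (racg \<Gamma>)"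
  unfolding word_val_def racg_def presented_group_def by (simp add: words_positive)

lemma word_val_Nil [simp]: "word_val [] = \<e>"
  by (simp add: word_val_def racg_def presented_group_def)

lemma word_val_append:
  "set u \<subseteq> pverts \<Gamma> \<Longrightarrow> set v \<subseteq> pverts \<Gamma> \<Longrightarrow> word_val (u @ v) = word_val u \<cdot> word_val v"
  by (simp add: word_val_def racg_def presented_group_mult words_positive)

lemma word_val_singleton: "word_val [s] = gen s"
  by (simp add: word_val_def racg_gen_def)

lemma word_val_Cons:
  "s \<in> pverts \<Gamma> \<Longrightarrow> set w \<subseteq> pverts \<Gamma> \<Longrightarrow> word_val (s # w) = gen s \<cdot> word_val w"
  using word_val_append[of "[s]" w] by (simp add: word_val_singleton)

lemma gen_closed [simp]: "s \<in> pverts \<Gamma> \<Longrightarrow> gen s \<in> carrier (racg \<Gamma>)"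
  using word_val_closed[of "[s]"] by (simp add: word_val_singleton)

lemma carrier_word_val:
  assumes "x \<in> carrier (racg \<Gamma>)"
  obtains w where "set w \<subseteq> pverts \<Gamma>" "x = word_val w"
proof -
  obtain w where w: "w \<in> words (pverts \<Gamma>)"
    and x: "x = pres_class (pverts \<Gamma>) (racg_relations \<Gamma>) w"
    using assms by (auto simp: racg_def presented_group_def)
  have V: "set (map fst w) \<subseteq> pverts \<Gamma>"
    using w by (auto simp: words_def in_lists_conv_set)
  moreover have "x = word_val (map fst w)"
    unfolding x word_val_def
    by (subst pres_class_eq_iff[OF words_positive[OF V]]) (rule signed_word_eq_positive[OF w])
  ultimately show thesis by (rule that)
qed

lemma adj_verts: "adj s t \<Longrightarrow> s \<in> pverts \<Gamma>" "adj s t \<Longrightarrow> t \<in> pverts \<Gamma>"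
  using arc_fst_in_verts[of "(s, t)"] arc_snd_in_verts[of "(s, t)"] by auto

lemma gen_square [simp]:
  assumes "s \<in> pverts \<Gamma>"
  shows "gen s \<cdot> gen s = \<e>"
proof -
  have "pres_eq (pverts \<Gamma>) (racg_relations \<Gamma>) ([] @ [(s, True), (s, True)] @ []) ([] @ [] @ [])"
    by (rule pres_eq.relation) (use assms in \<open>auto simp: words_def racg_relations_def\<close>)
  then have "word_val [s, s] = word_val []"
    unfolding word_val_def by (subst pres_class_eq_iff) (auto simp: words_def)
  then show ?thesis using assms by (simp add: word_val_Cons word_val_singleton)
qed

lemma gen_commute:
  assumes "adj s t"
  shows "gen s \<cdot> gen t = gen t \<cdot> gen s"
proof -
  have V: "s \<in> pverts \<Gamma>" "t \<in> pverts \<Gamma>" using adj_verts[OF assms] .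
  have "pres_eq (pverts \<Gamma>) (racg_relations \<Gamma>)
      ([] @ [(s, True), (t, True)] @ []) ([] @ [(t, True), (s, True)] @ [])"
    by (rule pres_eq.relation) (use assms V in \<open>auto simp: words_def racg_relations_def\<close>)
  then have "word_val [s, t] = word_val [t, s]"
    unfolding word_val_def by (subst pres_class_eq_iff) (use V in \<open>auto simp: words_def\<close>)
  then show ?thesis using V by (simp add: word_val_Cons word_val_singleton)
qed

lemma gen_cancel [simp]:
  "s \<in> pverts \<Gamma> \<Longrightarrow> x \<in> carrier (racg \<Gamma>) \<Longrightarrow> gen s \<cdot> (gen s \<cdot> x) = x"
  by (simp flip: W.m_assoc)

lemma inv_gen: "s \<in> pverts \<Gamma> \<Longrightarrow> inv\<^bsub>racg \<Gamma>\<^esub> (gen s) = gen s"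
  by (simp add: W.inv_equality)

lemma inv_word_val:
  "set w \<subseteq> pverts \<Gamma> \<Longrightarrow> inv\<^bsub>racg \<Gamma>\<^esub> (word_val w) = word_val (rev w)"
proof (induction w)
  case (Cons s w)
  then show ?case
    by (simp add: word_val_Cons word_val_append word_val_singleton W.inv_mult_group inv_gen)
qed simp

lemma word_val_move_front:
  assumes "set p \<subseteq> pverts \<Gamma>" "set q \<subseteq> pverts \<Gamma>" "s \<in> pverts \<Gamma>" "\<forall>x\<in>set p. adj s x"
  shows "word_val (p @ s # q) = word_val (s # p @ q)"
  using assms
proof (induction p)
  case (Cons x p)
  have "word_val (x # p @ s # q) = gen x \<cdot> (gen s \<cdot> word_val (p @ q))"
    using Cons by (simp add: word_val_Cons)
  also have "\<dots> = gen s \<cdot> (gen x \<cdot> word_val (p @ q))"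
    using Cons.prems gen_commute[of s x] by (simp flip: W.m_assoc)
  finally show ?case using Cons.prems by (simp add: word_val_Cons)
qed simp

lemma word_val_cong:
  assumes "u \<approx> v" "set u \<subseteq> pverts \<Gamma>"
  shows "word_val u = word_val v"
  using assms
proof (induction u arbitrary: v)
  case Nil
  then show ?case using trace_eq_length by fastforce
next
  case (Cons s u)
  obtain p q where v: "v = p @ s # q" and p: "\<forall>x\<in>set p. adj s x"
    using trace_eq_Cons_imp_leading[OF Cons.prems(1)] by (auto simp: leading_def)
  have V: "set v \<subseteq> pverts \<Gamma>" using Cons.prems trace_eq_set by blast
  have "u \<approx> p @ q"
    using trace_eq_Cons_imp_remove1[OF Cons.prems(1)] v remove1_split[OF p] by simp
  then have "word_val u = word_val (p @ q)" using Cons by simp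
  then show ?case
    using V Cons.prems v p word_val_move_front[of p q s] by (simp add: word_val_Cons)
qed

text \<open>The normal form of \<open>w\<close> is the result of letting the group element \<open>w\<close> act on the empty word;
  it is therefore invariant under the relations.\<close>

lemma pres_eq_imp_normal_form:
  "pres_eq (pverts \<Gamma>) (racg_relations \<Gamma>) u v \<Longrightarrow>
    normal_form (map fst u) \<approx> normal_form (map fst v)"
proof (induction rule: pres_eq.induct)
  case (cancel u v s e)
  then show ?case
    by (auto simp: normal_form_append
        intro!: foldr_left_mult_cong left_mult_involution reduced_normal_form)
next
  case (relation u v l r)
  then show ?case
    by (auto simp: normal_form_append racg_relations_def intro!: foldr_left_mult_cong
        left_mult_involution left_mult_commute reduced_normal_form)
qed (auto intro: trace_eq_sym trace_eq_trans)

text \<open>This is the solution of the word problem: a reduced word is its own normal form, and the normal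
  form depends only on the value.\<close>

lemma reduced_word_unique:
  assumes "reduced u" "reduced v" "set u \<subseteq> pverts \<Gamma>" "set v \<subseteq> pverts \<Gamma>"
    and "word_val u = word_val v"
  shows "u \<approx> v"
proof -
  have "pres_eq (pverts \<Gamma>) (racg_relations \<Gamma>)
      (map (\<lambda>s. (s, True)) u) (map (\<lambda>s. (s, True)) v)"
    using assms(5) pres_class_eq_iff[OF words_positive[OF assms(4)]] by (simp add: word_val_def)
  then have "normal_form u \<approx> normal_form v"
    using pres_eq_imp_normal_form by (fastforce simp: comp_def)
  from trace_eq_trans[OF trace_eq_trans[OF trace_eq_sym[OF normal_form_reduced] this]
      normal_form_reduced] show ?thesis
    using assms(1,2) .
qed

lemma nonreduced_imp_shorter:
  assumes "\<not> reduced w" "set w \<subseteq> pverts \<Gamma>"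
  obtains w' where "set w' \<subseteq> pverts \<Gamma>" "length w' < length w" "word_val w' = word_val w"
proof -
  obtain p s r where w: "w \<approx> p @ s # s # r"
    using assms(1) reduced_def by blast
  have V: "set (p @ s # s # r) \<subseteq> pverts \<Gamma>" using trace_eq_set[OF w] assms(2) by simp
  have "word_val (p @ r) = word_val w"
    using word_val_cong[OF w assms(2)] V by (simp add: word_val_append word_val_Cons)
  moreover have "length (p @ r) < length w" using trace_eq_length[OF w] by simp
  ultimately show thesis using that[of "p @ r"] V by simp
qed

section \<open>Involutions and their centralizers\<close>

text \<open>The reversal of \<open>s # w\<close> represents the inverse, which is the same element, so the two words agree
  up to commutation and \<open>s\<close> can also be moved to the end of \<open>s # w\<close>.  The letter that moves there is
  either the initial \<open>s\<close> itself or a later one.\<close>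

lemma involution_first_letter:
  assumes "reduced (s # w)" "set (s # w) \<subseteq> pverts \<Gamma>"
    and "word_val (s # w) \<cdot> word_val (s # w) = \<e>"
  shows "(\<forall>x\<in>set w. adj s x) \<or> (\<exists>p q. w = p @ s # q \<and> (\<forall>x\<in>set q. adj s x))"
proof -
  have "word_val (s # w) = inv\<^bsub>racg \<Gamma>\<^esub> (word_val (s # w))"
    using assms(2,3) W.inv_equality word_val_closed by metis
  then have "s # w \<approx> rev (s # w)"
    using assms(1,2) inv_word_val[OF assms(2)] reduced_rev[OF assms(1)]
    by (intro reduced_word_unique) auto
  then have "leading s (rev (s # w))" by (rule trace_eq_Cons_imp_leading)
  then obtain p q where pq: "rev w @ [s] = p @ s # q" and p: "\<forall>x\<in>set p. adj s x"
    unfolding leading_def by auto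
  show ?thesis
  proof (cases q rule: rev_cases)
    case Nil
    then show ?thesis using pq p by auto
  next
    case (snoc q' y)
    then have "rev w = p @ s # q'" using pq by simp
    from arg_cong[OF this, of rev] have "w = rev q' @ s # rev p" by simp
    moreover have "\<forall>x\<in>set (rev p). adj s x" using p by simp
    ultimately show ?thesis by blast
  qed
qed

text \<open>The listed values of \<open>c\<close> are the products over cliques with at most two vertices, which are all
  cliques of a triangle-free graph.\<close>

definition clique_conj :: "'a word set \<Rightarrow> bool" where
  "clique_conj x \<longleftrightarrow> (\<exists>z c. z \<in> carrier (racg \<Gamma>) \<and> x = z \<cdot> c \<cdot> inv\<^bsub>racg \<Gamma>\<^esub> z \<and>
     (c = \<e> \<or> (\<exists>s\<in>pverts \<Gamma>. c = gen s) \<or> (\<exists>s t. adj s t \<and> c = gen s \<cdot> gen t)))"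

lemma clique_conj_self:
  assumes "x = \<e> \<or> (\<exists>s\<in>pverts \<Gamma>. x = gen s) \<or> (\<exists>s t. adj s t \<and> x = gen s \<cdot> gen t)"
  shows "clique_conj x"
proof -
  have "x \<in> carrier (racg \<Gamma>)" using assms adj_verts by auto
  then have "x = \<e> \<cdot> x \<cdot> inv\<^bsub>racg \<Gamma>\<^esub> \<e>" by simp
  then show ?thesis unfolding clique_conj_def using assms W.one_closed by blast
qed

lemma clique_conj_gen:
  assumes "clique_conj x" "s \<in> pverts \<Gamma>"
  shows "clique_conj (gen s \<cdot> x \<cdot> gen s)"
proof -
  obtain z c where z: "z \<in> carrier (racg \<Gamma>)" and x: "x = z \<cdot> c \<cdot> inv\<^bsub>racg \<Gamma>\<^esub> z"
    and c: "c = \<e> \<or> (\<exists>s\<in>pverts \<Gamma>. c = gen s) \<or> (\<exists>s t. adj s t \<and> c = gen s \<cdot> gen t)"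
    using assms(1) unfolding clique_conj_def by blast
  have "c \<in> carrier (racg \<Gamma>)" using c adj_verts by auto
  then have "gen s \<cdot> x \<cdot> gen s = (gen s \<cdot> z) \<cdot> c \<cdot> inv\<^bsub>racg \<Gamma>\<^esub> (gen s \<cdot> z)"
    using z assms(2) by (simp add: x W.inv_mult_group inv_gen W.m_assoc)
  moreover have "gen s \<cdot> z \<in> carrier (racg \<Gamma>)" using z assms(2) by simp
  ultimately show ?thesis using c unfolding clique_conj_def by blast
qed

text \<open>Induction on the length of a word for the involution.  If a later occurrence of
  its first letter \<open>s\<close> can be moved to the end, then conjugation by \<open>s\<close> gives a shorter word.  Otherwise \<open>s\<close> is
  adjacent to all other letters, and the word without \<open>s\<close> again represents an involution.  Its letters
  are pairwise non-adjacent because there are no triangles, so it has at most one letter or begins and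
  ends with the same letter \<open>t\<close>; in the latter case, conjugation by \<open>t\<close>, which commutes with \<open>s\<close>, shortens
  the word.\<close>

lemma involution_clique_conj:
  assumes tf: "triangle_free \<Gamma>"
  shows "set w \<subseteq> pverts \<Gamma> \<Longrightarrow> word_val w \<cdot> word_val w = \<e> \<Longrightarrow> clique_conj (word_val w)"
proof (induction w rule: length_induct)
  case (1 w)
  have IH: "clique_conj (word_val v)"
    if "length v < length w" "set v \<subseteq> pverts \<Gamma>" "word_val v \<cdot> word_val v = \<e>" for v
    using 1 that by blast
  have conj: "clique_conj (word_val w)"
    if "length v < length w" "set v \<subseteq> pverts \<Gamma>" "s \<in> pverts \<Gamma>"
      "word_val w = gen s \<cdot> word_val v \<cdot> gen s" for v s
  proof -
    have "word_val v = gen s \<cdot> word_val w \<cdot> gen s"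
      using that by (simp add: W.m_assoc)
    then have "word_val v \<cdot> word_val v = gen s \<cdot> (word_val w \<cdot> word_val w) \<cdot> gen s"
      using that 1(2) by (simp add: W.m_assoc)
    then have "word_val v \<cdot> word_val v = \<e>" using 1(3) that(3) by simp
    then show ?thesis using IH that clique_conj_gen by simp
  qed
  show ?case
  proof (cases "reduced w")
    case False
    obtain v where "set v \<subseteq> pverts \<Gamma>" "length v < length w" "word_val v = word_val w"
      using nonreduced_imp_shorter[OF False 1(2)] .
    then show ?thesis using IH[of v] 1(3) by simp
  next
    case red: True
    show ?thesis
    proof (cases w)
      case Nil
      then show ?thesis by (simp add: clique_conj_self)
    next
      case w: (Cons s w')
      have s: "s \<in> pverts \<Gamma>" and w'V: "set w' \<subseteq> pverts \<Gamma>" using 1(2) w by auto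
      consider (cancel) p q where "w' = p @ s # q" "\<forall>x\<in>set q. adj s x"
        | (central) "\<forall>x\<in>set w'. adj s x"
        using involution_first_letter[of s w'] red 1 w by blast
      then show ?thesis
      proof cases
        case cancel
        have V: "set p \<subseteq> pverts \<Gamma>" "set q \<subseteq> pverts \<Gamma>" using w'V cancel(1) by auto
        have "word_val (q @ [s]) = word_val (s # q)"
          using word_val_move_front[of q "[]" s] V s cancel(2) by simp
        then have "word_val w = gen s \<cdot> word_val (p @ q) \<cdot> gen s"
          using V s by (simp add: w cancel(1) word_val_Cons word_val_append word_val_singleton
              W.m_assoc)
        then show ?thesis using conj[of "p @ q" s] V s w cancel(1) by simp
      next
        case central
        show ?thesis
        proof (cases w')
          case Nil
          then show ?thesis using w s by (auto simp: word_val_singleton intro: clique_conj_self)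
        next
          case w': (Cons t r)
          have st: "adj s t" and t: "t \<in> pverts \<Gamma>" and rV: "set r \<subseteq> pverts \<Gamma>"
            using central w' w'V by auto
          have "word_val w = word_val w' \<cdot> gen s"
            using word_val_move_front[of w' "[]" s] w'V s central w
            by (simp add: word_val_append word_val_singleton)
          then have "word_val w' = word_val w \<cdot> gen s"
            using w'V s by (simp add: W.m_assoc)
          moreover have "word_val w' = gen s \<cdot> word_val w"
            using w'V s by (simp add: w word_val_Cons)
          ultimately have "word_val w' \<cdot> word_val w' = (gen s \<cdot> word_val w) \<cdot> (word_val w \<cdot> gen s)"
            by simp
          also have "\<dots> = gen s \<cdot> (word_val w \<cdot> word_val w) \<cdot> gen s"
            using s 1(2) by (simp add: W.m_assoc)
          finally have w'2: "word_val w' \<cdot> word_val w' = \<e>" using 1(3) s by simp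
          \<comment> \<open>All letters of \<open>w'\<close> are neighbours of \<open>s\<close>.\<close>
          have no_triangle: "\<not> adj t x" if "x \<in> set r" for x
          proof
            assume "adj t x"
            moreover have "adj x s" using central that w' adj_sym by auto
            ultimately show False using tf st unfolding triangle_free_def by blast
          qed
          have "reduced w'" using red w by (simp add: reduced_Cons)
          then consider "\<forall>x\<in>set r. adj t x"
            | p q where "r = p @ t # q" "\<forall>x\<in>set q. adj t x"
            using involution_first_letter[of t r] w'V w'2 w' by blast
          then show ?thesis
          proof cases
            case 1
            then have "r = []" using no_triangle by (cases r) auto
            then show ?thesis
              using w w' st s t by (auto simp: word_val_Cons intro!: clique_conj_self)
          next
            case 2
            then have r: "r = p @ [t]" using no_triangle by (cases q) auto
            have pV: "set p \<subseteq> pverts \<Gamma>" using rV r by auto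
            have "word_val w = (gen s \<cdot> gen t) \<cdot> word_val p \<cdot> gen t"
              using pV s t by (simp add: w w' r word_val_Cons word_val_append W.m_assoc)
            also have "\<dots> = gen t \<cdot> word_val (s # p) \<cdot> gen t"
              using pV s t gen_commute[OF st] by (simp add: word_val_Cons W.m_assoc)
            finally show ?thesis using conj[of "s # p" t] pV s t w w' r by simp
          qed
        qed
      qed
    qed
  qed
qed

text \<open>Multiplication by \<open>s\<close> or \<open>t\<close> on either side preserves both the centralizer and the claimed set,
  so \<open>w\<close> may be stripped of all letters \<open>s\<close>, \<open>t\<close> that can be moved to its front or end.  After that
  \<open>s t w\<close> and \<open>w s t\<close> are reduced words for the same element.  The first letter of \<open>w\<close>, if there
  is one, can be moved to the front of \<open>s t w\<close>, so it is adjacent to \<open>s\<close> and \<open>t\<close>: a triangle.\<close>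

lemma centralizer_edge:
  assumes tf: "triangle_free \<Gamma>" and st: "adj s t"
  shows "set w \<subseteq> pverts \<Gamma> \<Longrightarrow> word_val w \<cdot> (gen s \<cdot> gen t) = gen s \<cdot> gen t \<cdot> word_val w \<Longrightarrow>
    word_val w \<in> {\<e>, gen s, gen t, gen s \<cdot> gen t}"
proof (induction w rule: length_induct)
  case (1 w)
  let ?C = "carrier (racg \<Gamma>)"
  let ?K = "{\<e>, gen s, gen t, gen s \<cdot> gen t}"
  define c where "c = gen s \<cdot> gen t"
  have s: "s \<in> pverts \<Gamma>" and t: "t \<in> pverts \<Gamma>" using adj_verts[OF st] .
  have c: "c \<in> ?C" using s t by (simp add: c_def)
  have comm: "gen t \<cdot> gen s = gen s \<cdot> gen t" using gen_commute[OF st] by simp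
  have comm': "gen t \<cdot> (gen s \<cdot> x) = gen s \<cdot> (gen t \<cdot> x)" if "x \<in> ?C" for x
    using comm s t that by (simp flip: W.m_assoc)
  have IH: "word_val v \<in> ?K"
    if "length v < length w" "set v \<subseteq> pverts \<Gamma>" "word_val v \<cdot> c = c \<cdot> word_val v" for v
    using 1 that unfolding c_def by blast
  have wc: "word_val w \<cdot> c = c \<cdot> word_val w" using 1(3) by (simp add: c_def)
  have K_left: "gen a \<cdot> x \<in> ?K" and K_right: "x \<cdot> gen a \<in> ?K"
    if "x \<in> ?K" "a \<in> {s, t}" for x a
    using that s t comm comm' by (auto simp: W.m_assoc)
  have ac: "gen a \<cdot> c = c \<cdot> gen a" if "a \<in> {s, t}" for a
    using that s t comm comm' by (auto simp: c_def W.m_assoc)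
  show ?case
  proof (cases "reduced w")
    case False
    obtain v where "set v \<subseteq> pverts \<Gamma>" "length v < length w" "word_val v = word_val w"
      using nonreduced_imp_shorter[OF False 1(2)] .
    then show ?thesis using IH[of v] wc by simp
  next
    case red: True
    consider (left) a where "a \<in> {s, t}" "leading a w"
      | (right) a where "a \<in> {s, t}" "leading a (rev w)"
      | (neither) "\<not> leading s w" "\<not> leading t w" "\<not> leading s (rev w)" "\<not> leading t (rev w)"
      by blast
    then show ?thesis
    proof cases
      case left
      let ?v = "remove1 a w"
      have a: "a \<in> pverts \<Gamma>" using left s t by auto
      have vV: "set ?v \<subseteq> pverts \<Gamma>" using 1(2) set_remove1_subset by fastforce
      have w: "w \<approx> a # ?v" using left(2) by (rule leading_imp_trace_eq)
      have wv: "word_val w = gen a \<cdot> word_val ?v"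
        using word_val_cong[OF w 1(2)] a vV by (simp add: word_val_Cons)
      then have v: "word_val ?v = gen a \<cdot> word_val w" using a vV by simp
      have "word_val ?v \<cdot> c = gen a \<cdot> (word_val w \<cdot> c)"
        using v a 1(2) c by (simp add: W.m_assoc)
      also have "\<dots> = (gen a \<cdot> c) \<cdot> word_val w"
        using wc a 1(2) c by (simp add: W.m_assoc)
      also have "\<dots> = c \<cdot> word_val ?v"
        using v ac[OF left(1)] a 1(2) c by (simp add: W.m_assoc)
      finally have "word_val ?v \<in> ?K" using IH[of ?v] vV trace_eq_length[OF w] by simp
      then show ?thesis using K_left[OF _ left(1)] wv by simp
    next
      case right
      let ?v = "rev (remove1 a (rev w))"
      have a: "a \<in> pverts \<Gamma>" using right s t by auto
      have vV: "set ?v \<subseteq> pverts \<Gamma>" using 1(2) set_remove1_subset by fastforce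
      have w: "w \<approx> ?v @ [a]"
        using trace_eq_rev[OF leading_imp_trace_eq[OF right(2)]] by simp
      have wv: "word_val w = word_val ?v \<cdot> gen a"
        using word_val_cong[OF w 1(2)] a vV by (simp add: word_val_append word_val_singleton)
      then have v: "word_val ?v = word_val w \<cdot> gen a" using a vV by (simp add: W.m_assoc)
      have "word_val ?v \<cdot> c = word_val w \<cdot> (c \<cdot> gen a)"
        using v ac[OF right(1)] a 1(2) c by (simp add: W.m_assoc)
      also have "\<dots> = c \<cdot> word_val ?v"
        using v wc a 1(2) c by (simp flip: W.m_assoc)
      finally have "word_val ?v \<in> ?K" using IH[of ?v] vV trace_eq_length[OF w] by simp
      then show ?thesis using K_right[OF _ right(1)] wv by simp
    next
      case neither
      have "s \<noteq> t" "t \<noteq> s" using st E_irrefl by auto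
      then have "reduced (s # t # w)" "reduced (t # s # rev w)"
        using neither red reduced_rev[OF red] by (auto simp: reduced_Cons leading_Cons)
      moreover from reduced_rev[OF this(2)] have "reduced (w @ [s, t])" by simp
      moreover have "word_val (s # t # w) = word_val (w @ [s, t])"
        using wc s t 1(2)
        by (simp add: c_def word_val_Cons word_val_append word_val_singleton W.m_assoc)
      ultimately have eq: "s # t # w \<approx> w @ [s, t]"
        using s t 1(2) by (intro reduced_word_unique) auto
      have "w = []"
      proof (cases w)
        case (Cons u r)
        then have u: "u \<noteq> s" "u \<noteq> t" using neither by auto
        have "leading u (s # t # w)"
          using leading_cong[OF eq] Cons by simp
        then have "adj u s" "adj u t" using u by (auto simp: leading_Cons)
        then show ?thesis using tf st adj_sym unfolding triangle_free_def by blast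
      qed simp
      then show ?thesis by simp
    qed
  qed
qed

text \<open>After conjugation \<open>a\<close> is \<open>s t\<close> for an edge, so \<open>b\<close> is \<open>s\<close> or \<open>t\<close> and \<open>a b\<close> is the other one.\<close>

lemma commuting_nonreflection:
  assumes tf: "triangle_free \<Gamma>" and a: "a \<in> carrier (racg \<Gamma>)" and b: "b \<in> carrier (racg \<Gamma>)"
    and a2: "a \<cdot> a = \<e>" and ab: "a \<cdot> b = b \<cdot> a"
    and ne: "a \<noteq> \<e>" "b \<noteq> \<e>" "a \<noteq> b"
    and nonrefl: "a \<notin> reflections \<Gamma>"
  shows "b \<in> reflections \<Gamma> \<and> a \<cdot> b \<in> reflections \<Gamma>"
proof -
  have "clique_conj a"
    using a carrier_word_val involution_clique_conj[OF tf] a2 by metis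
  then obtain z c where z: "z \<in> carrier (racg \<Gamma>)" and ac: "a = z \<cdot> c \<cdot> inv\<^bsub>racg \<Gamma>\<^esub> z"
    and "c = \<e> \<or> (\<exists>s\<in>pverts \<Gamma>. c = gen s) \<or> (\<exists>s t. adj s t \<and> c = gen s \<cdot> gen t)"
    unfolding clique_conj_def by blast
  moreover have "c \<noteq> \<e>" using ac z ne(1) by auto
  moreover have "\<not> (\<exists>s\<in>pverts \<Gamma>. c = gen s)"
    using ac z nonrefl unfolding reflections_def by blast
  ultimately obtain s t where st: "adj s t" and c: "c = gen s \<cdot> gen t" by blast
  have V: "s \<in> pverts \<Gamma>" "t \<in> pverts \<Gamma>" using adj_verts[OF st] .
  have cC: "c \<in> carrier (racg \<Gamma>)" using V by (simp add: c)
  define d where "d = inv\<^bsub>racg \<Gamma>\<^esub> z \<cdot> b \<cdot> z"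
  have dC: "d \<in> carrier (racg \<Gamma>)" using z b by (simp add: d_def)
  have z1: "z \<cdot> (inv\<^bsub>racg \<Gamma>\<^esub> z \<cdot> x) = x" and z2: "inv\<^bsub>racg \<Gamma>\<^esub> z \<cdot> (z \<cdot> x) = x"
    if "x \<in> carrier (racg \<Gamma>)" for x
    using that z by (simp_all flip: W.m_assoc)
  have bd: "b = z \<cdot> d \<cdot> inv\<^bsub>racg \<Gamma>\<^esub> z"
    using z b by (simp add: d_def W.m_assoc z1)
  have conj_mult: "(z \<cdot> x \<cdot> inv\<^bsub>racg \<Gamma>\<^esub> z) \<cdot> (z \<cdot> y \<cdot> inv\<^bsub>racg \<Gamma>\<^esub> z) = z \<cdot> (x \<cdot> y) \<cdot> inv\<^bsub>racg \<Gamma>\<^esub> z"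
    if "x \<in> carrier (racg \<Gamma>)" "y \<in> carrier (racg \<Gamma>)" for x y
    using that z by (simp add: W.m_assoc z2)
  have "z \<cdot> (c \<cdot> d) \<cdot> inv\<^bsub>racg \<Gamma>\<^esub> z = z \<cdot> (d \<cdot> c) \<cdot> inv\<^bsub>racg \<Gamma>\<^esub> z"
    using ab unfolding ac bd by (simp add: conj_mult cC dC)
  then have "d \<cdot> c = c \<cdot> d"
    using z cC dC by simp
  have ct: "c \<cdot> gen t = gen s" using V by (simp add: c W.m_assoc)
  have cs: "c \<cdot> gen s = gen t" using V by (simp add: c gen_commute[OF st] W.m_assoc)
  from \<open>d \<cdot> c = c \<cdot> d\<close> have "d \<in> {\<e>, gen s, gen t, gen s \<cdot> gen t}"
    using dC carrier_word_val centralizer_edge[OF tf st] unfolding c by metis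
  moreover have "d \<noteq> \<e>" using bd z ne(2) by auto
  moreover have "d \<noteq> gen s \<cdot> gen t" using bd ac c ne(3) by auto
  ultimately have "d = gen s \<and> c \<cdot> d = gen t \<or> d = gen t \<and> c \<cdot> d = gen s"
    using cs ct by blast
  moreover have "a \<cdot> b = z \<cdot> (c \<cdot> d) \<cdot> inv\<^bsub>racg \<Gamma>\<^esub> z"
    unfolding ac bd by (simp add: conj_mult cC dC)
  moreover have "z \<cdot> gen r \<cdot> inv\<^bsub>racg \<Gamma>\<^esub> z \<in> reflections \<Gamma>" if "r \<in> pverts \<Gamma>" for r
    using that z unfolding reflections_def by blast
  ultimately show ?thesis
    using bd V by metis
qed

lemma gen_ne_one: "s \<in> pverts \<Gamma> \<Longrightarrow> gen s \<noteq> \<e>"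
  using reduced_word_unique[of "[s]" "[]"] trace_eq_length[of "[s]" "[]"]
  by (auto simp: word_val_singleton reduced_Cons)

lemma gen_inj: "s \<in> pverts \<Gamma> \<Longrightarrow> t \<in> pverts \<Gamma> \<Longrightarrow> gen s = gen t \<Longrightarrow> s = t"
  using reduced_word_unique[of "[s]" "[t]"] trace_eq_set[of "[s]" "[t]"]
  by (auto simp: word_val_singleton reduced_Cons)

end

section \<open>Generation by reflections\<close>

theorem theorem11p4:
  fixes \<Gamma> :: "'a pair_pre_digraph" and \<Gamma>' :: "'b pair_pre_digraph"
    and G :: "'a word set set"
  assumes "pair_graph \<Gamma>" and "triangle_free \<Gamma>"
    and "subgroup G (racg \<Gamma>)"
    and "pair_graph \<Gamma>'" and "\<not> (\<exists>v. isolated_vertex \<Gamma>' v)"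
    and "(racg \<Gamma>)\<lparr>carrier := G\<rparr> \<cong> racg \<Gamma>'"
  shows "\<exists>R. finite R \<and> R \<subseteq> reflections \<Gamma> \<and> generate (racg \<Gamma>) R = G"
proof -
  interpret A: racg_graph \<Gamma> using assms(1) by (simp add: racg_graph_def)
  interpret B: racg_graph \<Gamma>' using assms(4) by (simp add: racg_graph_def)
  interpret G: subgroup G "racg \<Gamma>" by (rule assms(3))
  let ?W = "racg \<Gamma>" and ?W' = "racg \<Gamma>'"
  have "group (?W\<lparr>carrier := G\<rparr>)" using A.W.subgroup_imp_group assms(3) .
  then have "?W' \<cong> ?W\<lparr>carrier := G\<rparr>" using assms(6) group.iso_sym by blast
  then obtain h where h: "h \<in> iso ?W' (?W\<lparr>carrier := G\<rparr>)" by (auto simp: is_iso_def)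
  have h_mult: "h (x \<otimes>\<^bsub>?W'\<^esub> y) = h x \<otimes>\<^bsub>?W\<^esub> h y"
    if "x \<in> carrier ?W'" "y \<in> carrier ?W'" for x y
    using h that by (auto simp: iso_def hom_def)
  have h_bij: "bij_betw h (carrier ?W') G" using h by (auto simp: iso_def)
  then have h_G: "h x \<in> G" if "x \<in> carrier ?W'" for x
    using that by (auto simp: bij_betw_def)
  have h_W: "h x \<in> carrier ?W" if "x \<in> carrier ?W'" for x
    using h_G[OF that] G.subset by auto
  have h_inj: "x = y" if "h x = h y" "x \<in> carrier ?W'" "y \<in> carrier ?W'" for x y
    using h_bij that by (auto simp: bij_betw_def inj_on_def)
  have h_one: "h \<one>\<^bsub>?W'\<^esub> = \<one>\<^bsub>?W\<^esub>"
    using h_mult[of "\<one>\<^bsub>?W'\<^esub>" "\<one>\<^bsub>?W'\<^esub>"] h_W[of "\<one>\<^bsub>?W'\<^esub>"] by simp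
  define g where "g v = h (racg_gen \<Gamma>' v)" for v
  define X where "X = g ` pverts \<Gamma>' \<union> (\<lambda>(u, v). g u \<otimes>\<^bsub>?W\<^esub> g v) ` parcs \<Gamma>'"
  define R where "R = X \<inter> reflections \<Gamma>"
  have gG: "g v \<in> G" if "v \<in> pverts \<Gamma>'" for v using that h_G by (simp add: g_def)
  have gW: "g v \<in> carrier ?W" if "v \<in> pverts \<Gamma>'" for v using that h_W by (simp add: g_def)
  have "finite R"
    using B.pair_finite_verts B.pair_finite_arcs by (simp add: R_def X_def)
  moreover have "R \<subseteq> reflections \<Gamma>" by (simp add: R_def)
  moreover have "generate ?W R = G"
  proof
    have "X \<subseteq> G" using gG B.adj_verts by (auto simp: X_def)
    then show "generate ?W R \<subseteq> G"
      by (intro A.W.generate_subgroup_incl[OF _ assms(3)]) (auto simp: R_def)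
  next
    have gen_g: "g v \<in> generate ?W R" if v: "v \<in> pverts \<Gamma>'" for v
    proof (cases "g v \<in> reflections \<Gamma>")
      case True
      then show ?thesis using v by (auto simp: R_def X_def intro: generate.incl)
    next
      case False
      obtain u where vu: "(v, u) \<in> parcs \<Gamma>'"
        using assms(5) v by (auto simp: isolated_vertex_def)
      have u: "u \<in> pverts \<Gamma>'" and uv: "u \<noteq> v" using B.adj_verts[OF vu] vu B.E_irrefl by auto
      have comm: "g v \<otimes>\<^bsub>?W\<^esub> g u = g u \<otimes>\<^bsub>?W\<^esub> g v"
        using B.gen_commute[OF vu] u v by (simp add: g_def flip: h_mult)
      have sq: "g x \<otimes>\<^bsub>?W\<^esub> g x = \<one>\<^bsub>?W\<^esub>" if "x \<in> pverts \<Gamma>'" for x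
        using that by (simp add: g_def h_one flip: h_mult)
      have "g x \<noteq> \<one>\<^bsub>?W\<^esub>" if "x \<in> pverts \<Gamma>'" for x
        using that B.gen_ne_one h_inj[of "racg_gen \<Gamma>' x" "\<one>\<^bsub>?W'\<^esub>"] by (auto simp: g_def h_one)
      moreover have "g v \<noteq> g u"
        using u v uv B.gen_inj h_inj by (auto simp: g_def)
      ultimately have "g u \<in> reflections \<Gamma> \<and> g v \<otimes>\<^bsub>?W\<^esub> g u \<in> reflections \<Gamma>"
        using A.commuting_nonreflection[OF assms(2), of "g v" "g u"] gW u v sq comm False by blast
      moreover have "g v \<otimes>\<^bsub>?W\<^esub> g u \<in> X"
        using vu by (force simp: X_def)
      moreover have "g u \<in> X" using u by (simp add: X_def)
      ultimately have "g u \<in> generate ?W R" "g v \<otimes>\<^bsub>?W\<^esub> g u \<in> generate ?W R"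
        by (simp_all add: R_def generate.incl)
      then have "(g v \<otimes>\<^bsub>?W\<^esub> g u) \<otimes>\<^bsub>?W\<^esub> g u \<in> generate ?W R"
        by (rule generate.eng[rotated])
      then show ?thesis using gW u v sq by (simp add: A.W.m_assoc)
    qed
    have words: "h (B.word_val w) \<in> generate ?W R" if "set w \<subseteq> pverts \<Gamma>'" for w
      using that
    proof (induction w)
      case Nil
      then show ?case by (simp add: h_one generate.one)
    next
      case (Cons v w)
      then show ?case
        using gen_g[of v] by (auto simp: B.word_val_Cons h_mult g_def intro: generate.eng)
    qed
    show "G \<subseteq> generate ?W R"
    proof
      fix x
      assume "x \<in> G"
      then obtain y where "y \<in> carrier ?W'" "x = h y" using h_bij by (auto simp: bij_betw_def)
      then show "x \<in> generate ?W R" using words B.carrier_word_val by metis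
    qed
  qed
  ultimately show ?thesis by blast
qed

end
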